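(* Let $0<q<p\le1$, let $k$ be a positive integer and $n\ge1$. Then $$(-1)^n\frac{C_{n,p,q}^{(k)}(x)}{n!}=\sum_{m=1}^n\binom{n-1}{m-1}\frac{\widehat{C}_{m,p,q}^{(k)}(x)}{m!},\qquad (-1)^n\frac{\widehat{C}_{n,p,q}^{(k)}(x)}{n!}=\sum_{m=1}^n\binom{n-1}{m-1}\frac{C_{m,p,q}^{(k)}(x)}{m!}.$$
   Context: $[n]_{p,q}=\frac{p^n-q^n}{p-q}$. For $0<q<p\le1$ the $(p,q)$-integral is $\int_0^x f(t)\,d_{p,q}t=(p-q)x\sum_{n\ge0} \frac{q^n}{p^{n+1}}f\!\left(\frac{q^n}{p^{n+1}}x\right)$. With $(y)_n=y(y-1)\cdots(y-n+1)$, $(y)_0=1$, the $(p,q)$-poly-Cauchy polynomials of the first and second kinds are $C_{n,p,q}^{(k)}(x)=\int_0^1\cdots\int_0^1 (t_1\cdots t_k-x)_n\,d_{p,q}t_1\cdots d_{p,q}t_k$ and $\widehat{C}_{n,p,q}^{(k)}(x)=\int_0^1\cdots\int_0^1 (-t_1\cdots t_k+x)_n\,d_{p,q}t_1\cdots d_{p,q}t_k$ ($k$-fold). *)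

theory Defs
  imports Complex_Main
begin

definition falling_factorial :: "real \<Rightarrow> nat \<Rightarrow> real" where
  "falling_factorial y n = (\<Prod>i<n. y - real i)"

text \<open>The Jackson-type integral of \<open>f\<close> from \<open>0\<close> to \<open>x\<close>, meant for \<open>0 < q < p \<le> 1\<close>.\<close>

definition pq_integral :: "real \<Rightarrow> real \<Rightarrow> real \<Rightarrow> (real \<Rightarrow> real) \<Rightarrow> real" where
  "pq_integral p q x f =
     (p - q) * x * (\<Sum>n. q ^ n / p ^ (n + 1) * f (q ^ n / p ^ (n + 1) * x))"

text \<open>
  The \<open>k\<close>-fold iterated integral over \<open>[0, 1]\<close> of a function of the list
  \<open>[t\<^sub>1, \<dots>, t\<^sub>k]\<close>. As in the notation \<open>d t\<^sub>1 \<dots> d t\<^sub>k\<close>,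
  \<open>t\<^sub>1\<close> is the innermost variable and \<open>t\<^sub>k\<close> the outermost.
\<close>

primrec pq_multi_integral ::
  "real \<Rightarrow> real \<Rightarrow> nat \<Rightarrow> (real list \<Rightarrow> real) \<Rightarrow> real" where
  "pq_multi_integral p q 0 F = F []"
| "pq_multi_integral p q (Suc k) F =
     pq_integral p q 1 (\<lambda>t. pq_multi_integral p q k (\<lambda>ts. F (ts @ [t])))"

definition pq_poly_cauchy1 :: "nat \<Rightarrow> real \<Rightarrow> real \<Rightarrow> nat \<Rightarrow> real \<Rightarrow> real" where
  "pq_poly_cauchy1 n p q k x =
     pq_multi_integral p q k (\<lambda>ts. falling_factorial (prod_list ts - x) n)"

definition pq_poly_cauchy2 :: "nat \<Rightarrow> real \<Rightarrow> real \<Rightarrow> nat \<Rightarrow> real \<Rightarrow> real" where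
  "pq_poly_cauchy2 n p q k x =
     pq_multi_integral p q k (\<lambda>ts. falling_factorial (- prod_list ts + x) n)"

end

theory Submission
  imports Defs "HOL-Computational_Algebra.Polynomial" "HOL-Computational_Algebra.Formal_Power_Series"
begin

text \<open>
  Pointwise, both identities are the Chu--Vandermonde convolution applied to
  \<open>(- 1) ^ n * binom(y, n) = binom(-y + (n - 1), n)\<close>, with \<open>y = t\<^sub>1 \<cdots> t\<^sub>k - x\<close>
  or its negative. All integrands are polynomials in \<open>t\<^sub>1 \<cdots> t\<^sub>k\<close>; on these the
  multiple integral converges and is linear, since it sends \<open>(t\<^sub>1 \<cdots> t\<^sub>k) ^ i\<close> to the \<open>k\<close>-th
  power of the \<open>i\<close>-th moment of the \<open>(p,q)\<close>-integral.
\<close>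

lemma falling_factorial_eq_gbinomial:
  "falling_factorial y n / fact n = y gchoose n"
  by (simp add: falling_factorial_def gbinomial_prod_rev atLeast0LessThan)

lemma gbinomial_eq_sum_gbinomial_minus:
  fixes y :: real
  assumes "n \<ge> 1"
  shows "(- 1) ^ n * (y gchoose n) =
           (\<Sum>m=1..n. real ((n - 1) choose (m - 1)) * ((- y) gchoose m))"
proof -
  have "(- 1) ^ n * (y gchoose n) = (- y + real (n - 1)) gchoose n"
    using assms gbinomial_negated_upper[of y n]
    by (simp add: of_nat_diff algebra_simps flip: power_mult_distrib)
  also have "\<dots> = (\<Sum>m=0..n. ((- y) gchoose m) * (real (n - 1) gchoose (n - m)))"
    by (rule gbinomial_Vandermonde[symmetric])
  \<comment> \<open>The term \<open>m = 0\<close> carries \<open>(n - 1) choose n\<close>, which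
    vanishes because \<open>n \<ge> 1\<close>.\<close>
  also have "\<dots> = (\<Sum>m=1..n. ((- y) gchoose m) * (real (n - 1) gchoose (n - m)))"
    using assms
    by (simp add: sum.atLeast_Suc_atMost binomial_eq_0 del: of_nat_diff flip: binomial_gbinomial)
  also have "\<dots> = (\<Sum>m=1..n. real ((n - 1) choose (m - 1)) * ((- y) gchoose m))"
  proof (rule sum.cong)
    fix m assume "m \<in> {1..n}"
    then have "(n - 1) choose (n - m) = (n - 1) choose (m - 1)"
      by (subst binomial_symmetric) auto
    then show "((- y) gchoose m) * (real (n - 1) gchoose (n - m)) =
        real ((n - 1) choose (m - 1)) * ((- y) gchoose m)"
      by (simp flip: binomial_gbinomial)
  qed simp
  finally show ?thesis .
qed

text \<open>The terms are \<open>(q ^ n / p ^ (n + 1)) ^ (i + 1)\<close>, a geometric sequence in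
  \<open>n\<close> with ratio \<open>(q / p) ^ (i + 1) < 1\<close>.\<close>

lemma summable_pq_moment:
  fixes p q :: real
  assumes "0 < q" "q < p"
  shows "summable (\<lambda>n. q ^ n / p ^ (n + 1) * (q ^ n / p ^ (n + 1)) ^ i)"
proof -
  have "summable (\<lambda>n. (1 / p) ^ (i + 1) * ((q / p) ^ (i + 1)) ^ n)"
    using assms by (intro summable_mult summable_geometric) (simp add: power_less_one_iff del: power_Suc)
  also have "(\<lambda>n. (1 / p) ^ (i + 1) * ((q / p) ^ (i + 1)) ^ n) =
      (\<lambda>n. q ^ n / p ^ (n + 1) * (q ^ n / p ^ (n + 1)) ^ i)"
    by (simp add: fun_eq_iff power_divide power_mult_distrib power_add mult_ac flip: power_mult)
  finally show ?thesis .
qed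

lemma pq_integral_sum_powers:
  assumes "0 < q" "q < p"
  shows "pq_integral p q 1 (\<lambda>t. \<Sum>i\<le>N. c i * t ^ i) =
           (\<Sum>i\<le>N. c i * pq_integral p q 1 (\<lambda>t. t ^ i))"
proof -
  let ?w = "\<lambda>n. q ^ n / p ^ (n + 1)"
  have "(\<Sum>n. ?w n * (\<Sum>i\<le>N. c i * ?w n ^ i)) = (\<Sum>n. \<Sum>i\<le>N. c i * (?w n * ?w n ^ i))"
    by (simp add: sum_distrib_left mult_ac)
  \<comment> \<open>\<open>suminf\<close> commutes with a finite sum only if each series converges,
    which is what the moment lemma supplies.\<close>
  also have "\<dots> = (\<Sum>i\<le>N. \<Sum>n. c i * (?w n * ?w n ^ i))"
    by (intro suminf_sum summable_mult summable_pq_moment assms)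
  also have "\<dots> = (\<Sum>i\<le>N. c i * (\<Sum>n. ?w n * ?w n ^ i))"
    by (intro sum.cong refl suminf_mult summable_pq_moment assms)
  finally show ?thesis
    by (simp add: pq_integral_def sum_distrib_left mult_ac)
qed

text \<open>A power of the product factors over the variables, so each of the \<open>k\<close>
  integrations contributes one moment. The coefficients \<open>c\<close> stay arbitrary in the
  induction because they absorb the power of the outermost variable.\<close>

lemma pq_multi_integral_sum_powers:
  assumes "0 < q" "q < p"
  shows "pq_multi_integral p q k (\<lambda>ts. \<Sum>i\<le>N. c i * prod_list ts ^ i) =
           (\<Sum>i\<le>N. c i * pq_integral p q 1 (\<lambda>t. t ^ i) ^ k)"
proof (induction k arbitrary: c)
  case 0
  show ?case by simp
next
  case (Suc k)
  have "pq_multi_integral p q k (\<lambda>ts. \<Sum>i\<le>N. c i * prod_list (ts @ [t]) ^ i) =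
      (\<Sum>i\<le>N. c i * pq_integral p q 1 (\<lambda>t. t ^ i) ^ k * t ^ i)" for t
    using Suc.IH[of "\<lambda>i. c i * t ^ i"] by (simp add: power_mult_distrib mult_ac)
  then have "pq_multi_integral p q (Suc k) (\<lambda>ts. \<Sum>i\<le>N. c i * prod_list ts ^ i) =
      pq_integral p q 1 (\<lambda>t. \<Sum>i\<le>N. c i * pq_integral p q 1 (\<lambda>t. t ^ i) ^ k * t ^ i)"
    by (simp only: pq_multi_integral.simps)
  then show ?case
    unfolding pq_integral_sum_powers[OF assms] by (simp add: mult_ac)
qed

text \<open>A free bound \<open>N\<close> in place of \<open>degree P\<close> lets several
  polynomials be expanded over one common index range.\<close>

lemma pq_multi_integral_poly:
  assumes "0 < q" "q < p" "degree P \<le> N"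
  shows "pq_multi_integral p q k (\<lambda>ts. poly P (prod_list ts)) =
           (\<Sum>i\<le>N. coeff P i * pq_integral p q 1 (\<lambda>t. t ^ i) ^ k)"
proof -
  have "poly P y = (\<Sum>i\<le>N. coeff P i * y ^ i)" for y
    unfolding poly_altdef using assms(3)
    by (intro sum.mono_neutral_left) (auto simp: coeff_eq_0)
  then show ?thesis
    by (simp add: pq_multi_integral_sum_powers[OF assms(1,2)])
qed

lemma pq_multi_integral_sum_poly:
  assumes "0 < q" "q < p" "finite S"
  shows "pq_multi_integral p q k (\<lambda>ts. \<Sum>m\<in>S. a m * poly (P m) (prod_list ts)) =
           (\<Sum>m\<in>S. a m * pq_multi_integral p q k (\<lambda>ts. poly (P m) (prod_list ts)))"
proof -
  define Q where "Q = (\<Sum>m\<in>S. smult (a m) (P m))"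
  \<comment> \<open>A crude common bound for the degrees of \<open>Q\<close> and of every
    \<open>P m\<close>.\<close>
  define N where "N = degree Q + (\<Sum>m\<in>S. degree (P m))"
  let ?M = "\<lambda>i. pq_integral p q 1 (\<lambda>t. t ^ i) ^ k"
  have N: "degree (P m) \<le> N" if "m \<in> S" for m
    using member_le_sum[of m S "\<lambda>m. degree (P m)"] that assms(3) by (simp add: N_def)
  have "pq_multi_integral p q k (\<lambda>ts. \<Sum>m\<in>S. a m * poly (P m) (prod_list ts)) =
      pq_multi_integral p q k (\<lambda>ts. poly Q (prod_list ts))"
    by (simp add: Q_def poly_sum)
  also have "\<dots> = (\<Sum>i\<le>N. coeff Q i * ?M i)"
    by (intro pq_multi_integral_poly assms) (simp add: N_def)
  also have "\<dots> = (\<Sum>i\<le>N. \<Sum>m\<in>S. a m * (coeff (P m) i * ?M i))"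
    by (simp add: Q_def coeff_sum sum_distrib_right mult_ac)
  also have "\<dots> = (\<Sum>m\<in>S. a m * (\<Sum>i\<le>N. coeff (P m) i * ?M i))"
    by (subst sum.swap) (simp add: sum_distrib_left)
  also have "\<dots> = (\<Sum>m\<in>S. a m * pq_multi_integral p q k (\<lambda>ts. poly (P m) (prod_list ts)))"
    by (intro sum.cong refl) (simp add: pq_multi_integral_poly[OF assms(1,2) N])
  finally show ?thesis .
qed

lemma falling_factorial_linear_eq_poly:
  "falling_factorial (a * y + b) n = poly (\<Prod>i<n. [:b - real i, a:]) y"
  by (simp add: falling_factorial_def poly_prod algebra_simps)

text \<open>The pair \<open>(a, b) = (1, - x)\<close> gives the first kind and
  \<open>(- 1, x)\<close> the second. Negating both entries swaps the kinds, so this single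
  statement covers both identities.\<close>

lemma pq_multi_integral_falling_factorial_reflect:
  fixes a b :: real
  assumes "0 < q" "q < p" "n \<ge> 1"
  shows "(- 1) ^ n * (pq_multi_integral p q k (\<lambda>ts. falling_factorial (a * prod_list ts + b) n) / fact n) =
    (\<Sum>m=1..n. real ((n - 1) choose (m - 1)) *
      (pq_multi_integral p q k (\<lambda>ts. falling_factorial (- a * prod_list ts + - b) m) / fact m))"
proof -
  \<comment> \<open>The left side is written as a sum over \<open>{n}\<close> so that linearity in
    the form of \<open>pq_multi_integral_sum_poly\<close> also pulls the scalar out of a single
    integral.\<close>
  have pointwise: "(\<Sum>m\<in>{n}. (- 1) ^ n / fact n * falling_factorial (a * y + b) m) =
      (\<Sum>m=1..n. real ((n - 1) choose (m - 1)) / fact m * falling_factorial (- a * y + - b) m)" for y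
    using gbinomial_eq_sum_gbinomial_minus[OF assms(3), of "a * y + b"]
    by (simp add: algebra_simps flip: falling_factorial_eq_gbinomial)
  have "pq_multi_integral p q k
        (\<lambda>ts. \<Sum>m\<in>{n}. (- 1) ^ n / fact n * falling_factorial (a * prod_list ts + b) m) =
      pq_multi_integral p q k
        (\<lambda>ts. \<Sum>m=1..n. real ((n - 1) choose (m - 1)) / fact m *
                falling_factorial (- a * prod_list ts + - b) m)"
    by (simp only: pointwise)
  then show ?thesis
    unfolding falling_factorial_linear_eq_poly
    by (subst (asm) (1 2) pq_multi_integral_sum_poly[OF assms(1,2)]) simp_all
qed

theorem theorem15:
  fixes p q x :: real and k n :: nat
  assumes "0 < q" and "q < p" and "p \<le> 1" and "k \<ge> 1" and "n \<ge> 1"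
  shows "(- 1) ^ n * (pq_poly_cauchy1 n p q k x / fact n) =
           (\<Sum>m=1..n. real ((n - 1) choose (m - 1)) * (pq_poly_cauchy2 m p q k x / fact m))
       \<and> (- 1) ^ n * (pq_poly_cauchy2 n p q k x / fact n) =
           (\<Sum>m=1..n. real ((n - 1) choose (m - 1)) * (pq_poly_cauchy1 m p q k x / fact m))"
  using pq_multi_integral_falling_factorial_reflect[OF assms(1,2,5), of k 1 "- x"]
    pq_multi_integral_falling_factorial_reflect[OF assms(1,2,5), of k "- 1" x]
  by (simp add: pq_poly_cauchy1_def pq_poly_cauchy2_def)

end
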